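(* Let $D\subseteq X$ be a nonempty convex set, let $A,B:(D-D)\to\mathscr{P}_0(Y)$ be set-valued maps, and put $K:=\overline{\mathrm{rec}}(B)$. Let $F:D\to\mathscr{P}_0(Y)$ be a set-valued map which satisfies $$\frac{F(x)+F(y)}{2}+A(x-y)\subseteq \mathrm{cl}\Big(F\Big(\frac{x+y}{2}\Big)+B(x-y)\Big)\qquad (x,y\in D).$$ Assume in addition that: (i) for all $x\in D$, $F(x)$ is closedly $K$-starshaped with respect to some element of $Y$ and also closedly $K$-lower bounded; (ii) $F$ is directionally $K$-upper semicontinuous on $D$ (i.e. at every point of $D$); (iii) for all $u\in D-D$, the sets $A(u)$ and $B(u)$ are closedly $K$-starshaped and closedly $K$-lower bounded, and $B(u)$ is also closedly $K$-convex; (iv) for all $u\in D-D$, the sequences $\big(A\big(\frac{u}{2^k}\big)\big)_{k\ge 0}$ and $\big(B\big(\frac{u}{2^k}\big)\big)_{k\ge 0}$ are serially $K$-Cauchy. Then $$tF(x)+(1-t)F(y)+A^\perp(t,x-y)\subseteq \mathrm{cl}\big(F(tx+(1-t)y)+B^\perp(t,x-y)+K\big)\qquad (x,y\in D,\ t\in[0,1]).$$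
   Context: $X$ is a real linear space and $Y$ is a real Hausdorff topological vector space. $\mathscr{P}_0(Y)$ is the family of nonempty subsets of $Y$; $\mathscr{U}(Y)$ is a base of balanced neighborhoods of zero in $Y$; $\mathrm{cl}$ is the closure in $Y$. Sums and scalar multiples of sets are in the Minkowski sense (so $0\cdot S=\{0\}$ for nonempty $S$), and $D-D=\{x-y: x,y\in D\}$. Recession cones: for nonempty $S\subseteq Y$, $\mathrm{rec}(S):=\{y\in Y: ty+S\subseteq S \text{ for all } t\ge 0\}$. For a set-valued map $B$ on $D-D$, $\mathrm{rec}(B):=\bigcap_{u\in D-D}\mathrm{rec}(B(u))$, and $\overline{\mathrm{rec}}(B)$ is the closure of $\mathrm{rec}(B)$ (a convex cone containing $0$). For a convex cone $K\subseteq Y$: a set $S\subseteq Y$ is closedly $K$-convex if $tS+(1-t)S\subseteq\mathrm{cl}(S+K)$ for all $t\in[0,1]$; it is closedly $K$-starshaped with respect to $y\in Y$ if $tS+(1-t)y\subseteq\mathrm{cl}(S+K)$ for all $t\in[0,1]$; it is closedly $K$-starshaped if it is so with respect to $y=0$. A set $H\subseteq Y$ is bounded if for every $U\in\mathscr{U}(Y)$ there is $t>0$ with $tH\subseteq U$. $S$ is closedly $K$-lower bounded if there is a bounded $H\subseteq Y$ with $S\subseteq\mathrm{cl}(H+K)$. A sequence $(S_k)$ of subsets of $Y$ is serially $K$-Cauchy if for all $U\in\mathscr{U}(Y)$ there exists $m\in\mathbb{N}$ such that $\sum_{k=m}^n S_k\subseteq U+K$ for all $n\ge m$. $F:D\to\mathscr{P}_0(Y)$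 is directionally $K$-upper semicontinuous at $p\in D$ if for every $h\in X$ and every $U\in\mathscr{U}(Y)$ there is $\delta>0$ such that $F(p+th)\subseteq F(p)+U+K$ for all $0<t<\delta$ with $p+th\in D$. Tabor transformation: with $d_{\mathbb{Z}}(t):=\inf_{k\in\mathbb{Z}}|k-t|$, for a set-valued map $S:D-D\to\mathscr{P}_0(Y)$, $$S^\perp(t,u):=\mathrm{cl}\Big(\bigcup_{n=0}^\infty\sum_{k=0}^n 2d_{\mathbb{Z}}(2^kt)\,S\Big(\frac{u}{2^k}\Big)\Big)\qquad (t\in\mathbb{R},\ u\in D-D).$$ *)

theory Defs
  imports "HOL-Analysis.Analysis" "HOL-Library.Set_Algebras"
begin

class real_hausdorff_tvs = real_vector + topological_ab_group_add + t2_space +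
  assumes tendsto_scaleR_Pair:
    "((\<lambda>p. fst p *\<^sub>R snd p) \<longlongrightarrow> c *\<^sub>R x) (nhds c \<times>\<^sub>F nhds x)"

instance real_normed_vector \<subseteq> real_hausdorff_tvs
  by standard (intro tendsto_intros filterlim_fst filterlim_snd)

text \<open>
  Sums of sets are the Minkowski sums of \<^theory>\<open>HOL-Library.Set_Algebras\<close>, both for binary \<open>+\<close>
  and for \<open>\<Sum>\<close>. The operation \<open>-\<close> on sets is set difference, so the Minkowski difference
  \<open>D - D\<close> needs a name of its own.
\<close>

abbreviation scale_set :: "real \<Rightarrow> 'a::real_vector set \<Rightarrow> 'a set"  (infixr "*\<^sub>S" 75)
  where "t *\<^sub>S S \<equiv> (\<lambda>y. t *\<^sub>R y) ` S"

definition diff_set :: "'a::ab_group_add set \<Rightarrow> 'a set"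
  where "diff_set D = {x - y | x y. x \<in> D \<and> y \<in> D}"

definition balanced :: "'a::real_vector set \<Rightarrow> bool"
  where "balanced U \<longleftrightarrow> (\<forall>t. \<bar>t\<bar> \<le> 1 \<longrightarrow> t *\<^sub>S U \<subseteq> U)"

text \<open>
  The notions below that refer to neighbourhoods of zero take the chosen base \<open>\<U>\<close> as an argument.
  Its members need not be open.
\<close>

definition balanced_nhds_base :: "'a::real_hausdorff_tvs set set \<Rightarrow> bool"
  where "balanced_nhds_base \<U> \<longleftrightarrow>
    (\<forall>U\<in>\<U>. balanced U \<and> (\<exists>W. open W \<and> 0 \<in> W \<and> W \<subseteq> U)) \<and>
    (\<forall>W. open W \<and> 0 \<in> W \<longrightarrow> (\<exists>U\<in>\<U>. U \<subseteq> W))"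

definition recession_cone :: "'a::real_vector set \<Rightarrow> 'a set"
  where "recession_cone S = {y. \<forall>t\<ge>0. {t *\<^sub>R y} + S \<subseteq> S}"

definition recession_cone_map :: "'x set \<Rightarrow> ('x \<Rightarrow> 'a::real_vector set) \<Rightarrow> 'a set"
  where "recession_cone_map E B = (\<Inter>u\<in>E. recession_cone (B u))"

definition closedly_convex :: "'a::real_hausdorff_tvs set \<Rightarrow> 'a set \<Rightarrow> bool"
  where "closedly_convex K S \<longleftrightarrow>
    (\<forall>t\<in>{0..1}. t *\<^sub>S S + (1 - t) *\<^sub>S S \<subseteq> closure (S + K))"

definition closedly_starshaped_wrt :: "'a::real_hausdorff_tvs set \<Rightarrow> 'a \<Rightarrow> 'a set \<Rightarrow> bool"
  where "closedly_starshaped_wrt K y S \<longleftrightarrow>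
    (\<forall>t\<in>{0..1}. t *\<^sub>S S + {(1 - t) *\<^sub>R y} \<subseteq> closure (S + K))"

definition closedly_starshaped :: "'a::real_hausdorff_tvs set \<Rightarrow> 'a set \<Rightarrow> bool"
  where "closedly_starshaped K S \<longleftrightarrow> closedly_starshaped_wrt K 0 S"

definition tvs_bounded :: "'a::real_hausdorff_tvs set set \<Rightarrow> 'a set \<Rightarrow> bool"
  where "tvs_bounded \<U> H \<longleftrightarrow> (\<forall>U\<in>\<U>. \<exists>t>0. t *\<^sub>S H \<subseteq> U)"

definition closedly_lower_bounded ::
    "'a::real_hausdorff_tvs set set \<Rightarrow> 'a set \<Rightarrow> 'a set \<Rightarrow> bool"
  where "closedly_lower_bounded \<U> K S \<longleftrightarrow> (\<exists>H. tvs_bounded \<U> H \<and> S \<subseteq> closure (H + K))"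

definition serially_Cauchy ::
    "'a::real_hausdorff_tvs set set \<Rightarrow> 'a set \<Rightarrow> (nat \<Rightarrow> 'a set) \<Rightarrow> bool"
  where "serially_Cauchy \<U> K S \<longleftrightarrow>
    (\<forall>U\<in>\<U>. \<exists>m. \<forall>n\<ge>m. (\<Sum>k=m..n. S k) \<subseteq> U + K)"

definition directionally_usc_at ::
    "'a::real_hausdorff_tvs set set \<Rightarrow> 'a set \<Rightarrow> 'x::real_vector set \<Rightarrow> ('x \<Rightarrow> 'a set) \<Rightarrow> 'x \<Rightarrow> bool"
  where "directionally_usc_at \<U> K D F p \<longleftrightarrow>
    (\<forall>h. \<forall>U\<in>\<U>. \<exists>\<delta>>0. \<forall>t. 0 < t \<and> t < \<delta> \<and> p + t *\<^sub>R h \<in> D \<longrightarrow>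
      F (p + t *\<^sub>R h) \<subseteq> F p + U + K)"

definition dist_Ints :: "real \<Rightarrow> real"
  where "dist_Ints t = (INF k::int. \<bar>of_int k - t\<bar>)"

definition tabor ::
    "('x::real_vector \<Rightarrow> 'a::real_hausdorff_tvs set) \<Rightarrow> real \<Rightarrow> 'x \<Rightarrow> 'a set"
  where "tabor S t u =
    closure (\<Union>n. \<Sum>k=0..n. (2 * dist_Ints (2 ^ k * t)) *\<^sub>S S (u /\<^sub>R 2 ^ k))"

end

theory Submission
  imports Defs
begin

text \<open>
  Write \<open>S \<sqsubseteq> T\<close> for \<open>S \<subseteq> cl (T + K)\<close>. As \<open>K\<close> is a convex cone, this is a preorder compatible with
  Minkowski sums and nonnegative scaling, so the proof can follow the one for real functions.
  For \<open>t = m / 2\<^sup>n\<close> the inequality, with both Tabor sums cut off at \<open>k < n\<close>, is proved by induction: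
  an odd numerator makes \<open>t\<close> the midpoint of two neighbours \<open>a, b\<close> of level \<open>n\<close>; the functions
  \<open>s \<mapsto> d\<^sub>\<int>(2\<^sup>k s)\<close> with \<open>k < n\<close> are affine on \<open>[a, b]\<close>, and the convexity of \<open>B\<close> recombines the two
  halves of each summand. For general \<open>t\<close>, let \<open>t\<^sub>j = \<lfloor>2\<^sup>j t\<rfloor> / 2\<^sup>j\<close>. The points
  \<open>t\<^sub>j x + (1 - t\<^sub>j) y\<close> approach the limit point along the single direction \<open>y - x\<close>, so directional
  semicontinuity of \<open>F\<close> applies; every finite sum depends continuously on \<open>t\<^sub>j\<close> up to \<open>\<sqsubseteq>\<close>, and
  the tails on the right are controlled by the Cauchy condition on \<open>B\<close>. On the left a finite sum
  can be extended up to \<open>j\<close> since \<open>0 \<sqsubseteq> A u\<close> by starshapedness.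
\<close>

section \<open>Minkowski operations in topological vector spaces\<close>

text \<open>Addition is continuous on the product space, and a product of closures is the closure of
  the product.\<close>

lemma closure_set_plus_subset:
  fixes S T :: "'a::topological_ab_group_add set"
  shows "closure S + closure T \<subseteq> closure (S + T)"
proof -
  have eq: "P + Q = (\<lambda>p. fst p + snd p) ` (P \<times> Q)" for P Q :: "'a set"
    by (force simp: set_plus_def image_iff)
  have "(\<lambda>p. fst p + snd p) ` closure (S \<times> T) \<subseteq> closure ((\<lambda>p. fst p + snd p) ` (S \<times> T))"
    by (intro image_closure_subset closure_subset closed_closure continuous_intros)
  then show ?thesis
    by (simp add: eq closure_Times)
qed

lemma continuous_on_scaleR_tvs: "continuous_on A (\<lambda>x::'a::real_hausdorff_tvs. c *\<^sub>R x)"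
proof -
  have "((\<lambda>y. c *\<^sub>R y) \<longlongrightarrow> c *\<^sub>R x) (nhds x)" for x :: 'a
    using filterlim_compose[OF tendsto_scaleR_Pair
        filterlim_Pair[OF tendsto_const[of c] filterlim_ident]]
    by simp
  then show ?thesis
    unfolding continuous_on_def using filterlim_mono[OF _ order_refl at_within_le_nhds] by blast
qed

lemma scale_set_closure_subset:
  fixes S :: "'a::real_hausdorff_tvs set"
  shows "c *\<^sub>S closure S \<subseteq> closure (c *\<^sub>S S)"
  by (intro image_closure_subset closure_subset closed_closure continuous_on_scaleR_tvs)

lemma eventually_scaleR_mem:
  fixes y :: "'a::real_hausdorff_tvs"
  assumes "(c \<longlongrightarrow> 0) G" "open W" "0 \<in> W"
  shows "\<forall>\<^sub>F j in G. c j *\<^sub>R y \<in> W"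
proof -
  have "((\<lambda>j. c j *\<^sub>R y) \<longlongrightarrow> 0 *\<^sub>R y) G"
    using filterlim_compose[OF tendsto_scaleR_Pair filterlim_Pair[OF assms(1) tendsto_const]]
    by simp
  then show ?thesis
    using assms(2,3) by (auto dest: topological_tendstoD)
qed

lemma half_nhd:
  fixes W :: "'a::topological_ab_group_add set"
  assumes "open W" "0 \<in> W"
  obtains V where "open V" "0 \<in> V" "V + V \<subseteq> W"
proof -
  have "open ((\<lambda>p. fst p + snd p) -` W)"
    using assms(1) by (intro open_vimage continuous_intros)
  moreover have "(0, 0) \<in> (\<lambda>p. fst p + snd p) -` W"
    using assms(2) by simp
  ultimately obtain P Q where "open P" "open Q" "(0, 0) \<in> P \<times> Q"
    and "P \<times> Q \<subseteq> (\<lambda>p. fst p + snd p) -` W"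
    by (rule open_prod_elim)
  then show thesis
    by (intro that[of "P \<inter> Q"]) (auto elim!: set_plus_elim)
qed

lemma scale_set_plus: "c *\<^sub>S (S + T) = c *\<^sub>S S + c *\<^sub>S (T :: 'a::real_vector set)"
proof -
  have "c *\<^sub>R a + c *\<^sub>R b \<in> c *\<^sub>S (S + T)" if "a \<in> S" "b \<in> T" for a b
    using imageI[OF set_plus_intro[OF that], of "\<lambda>y. c *\<^sub>R y"] by (simp only: scaleR_add_right)
  then show ?thesis
    by (fastforce simp: scaleR_add_right elim!: set_plus_elim intro: set_plus_intro)
qed

lemma scale_set_zero: "c *\<^sub>S (0 :: 'a::real_vector set) = 0"
  by simp

lemma scale_set_sum: "c *\<^sub>S (\<Sum>i\<in>I. S i) = (\<Sum>i\<in>I. c *\<^sub>S (S i :: 'a::real_vector set))"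
  by (induction I rule: infinite_finite_induct) (simp_all add: scale_set_zero scale_set_plus)

lemma scale_set_scale_set: "a *\<^sub>S b *\<^sub>S S = (a * b) *\<^sub>S (S :: 'a::real_vector set)"
  by (simp add: image_image)

text \<open>One vector may be used in both summands, so this direction holds for every set. The
  reverse is a convexity property; \<open>closedly_convex_scale_below\<close> gives it up to
  closure.\<close>

lemma scale_set_add_subset: "(a + b) *\<^sub>S S \<subseteq> a *\<^sub>S S + b *\<^sub>S (S :: 'a::real_vector set)"
  by (auto simp: scaleR_add_left)

lemma balanced_nhds_baseE:
  assumes "balanced_nhds_base \<U>" "open W" "0 \<in> W"
  obtains U where "U \<in> \<U>" "balanced U" "U \<subseteq> W"
  using assms unfolding balanced_nhds_base_def by metis

text \<open>Boundedness supplies one factor \<open>r\<close> that carries \<open>H\<close> into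
  \<open>U\<close>; balancedness of \<open>U\<close> extends this to all factors of modulus less
  than \<open>r\<close>.\<close>

lemma tvs_bounded_eventually:
  assumes "balanced_nhds_base \<U>" "tvs_bounded \<U> H" "(c \<longlongrightarrow> 0) G" "open W" "0 \<in> W"
  shows "\<forall>\<^sub>F j in G. c j *\<^sub>S H \<subseteq> W"
proof -
  obtain U where U: "U \<in> \<U>" "balanced U" "U \<subseteq> W"
    using balanced_nhds_baseE[OF assms(1,4,5)] by metis
  obtain r where r: "r > 0" "r *\<^sub>S H \<subseteq> U"
    using assms(2) U(1) unfolding tvs_bounded_def by blast
  have "\<forall>\<^sub>F j in G. \<bar>c j\<bar> < r"
    using tendstoD[OF assms(3) r(1)] by (simp add: dist_real_def)
  then show ?thesis
  proof eventually_elim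
    case (elim j)
    then have "\<bar>c j / r\<bar> \<le> 1"
      using r(1) by simp
    then have "(c j / r) *\<^sub>S U \<subseteq> U"
      using U(2) unfolding balanced_def by blast
    moreover have "c j *\<^sub>S H = (c j / r) *\<^sub>S r *\<^sub>S H"
      unfolding scale_set_scale_set using r(1) by simp
    ultimately show ?case
      using r(2) U(3) by (metis image_mono order_trans)
  qed
qed

section \<open>Inclusion up to closure and a cone\<close>

text \<open>A convex cone containing zero. \<open>zero_mem\<close> makes \<open>below\<close>
  reflexive, \<open>add_eq\<close> makes it transitive and additive, and \<open>scale_subset\<close>
  makes it compatible with nonnegative factors.\<close>

locale nonneg_cone =
  fixes K :: "'a::real_hausdorff_tvs set"
  assumes zero_mem: "0 \<in> K"
    and add_subset: "K + K \<subseteq> K"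
    and scale_subset: "0 \<le> c \<Longrightarrow> c *\<^sub>S K \<subseteq> K"
begin

definition below :: "'a set \<Rightarrow> 'a set \<Rightarrow> bool"  (infix "\<sqsubseteq>" 50)
  where "S \<sqsubseteq> T \<longleftrightarrow> S \<subseteq> closure (T + K)"

lemma add_eq: "K + K = K"
  using add_subset set_zero_plus2[OF zero_mem, of K] by blast

lemma subset_add: "S \<subseteq> S + K"
  using set_zero_plus2[OF zero_mem, of S] by (simp add: add.commute)

lemma below_closure: "S \<subseteq> closure T \<Longrightarrow> S \<sqsubseteq> T"
  unfolding below_def using closure_mono[OF subset_add] by blast

lemma below_subset: "S \<subseteq> T \<Longrightarrow> S \<sqsubseteq> T"
  using below_closure closure_subset by blast

lemma below_refl: "S \<sqsubseteq> S"
  by (simp add: below_subset)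

lemma below_add_cone: "S + K \<sqsubseteq> S"
  by (simp add: below_def closure_subset)

text \<open>Adding \<open>K\<close> to both sides of the second relation costs nothing, since the
  extra copy of \<open>K\<close> is absorbed by \<open>K + K = K\<close>.\<close>

lemma below_trans [trans]: "S \<sqsubseteq> T \<Longrightarrow> T \<sqsubseteq> R \<Longrightarrow> S \<sqsubseteq> R"
proof -
  assume "S \<sqsubseteq> T" "T \<sqsubseteq> R"
  have "T + K \<subseteq> closure (R + K) + closure K"
    using \<open>T \<sqsubseteq> R\<close> unfolding below_def by (intro set_plus_mono2 closure_subset)
  also have "\<dots> \<subseteq> closure (R + K + K)"
    by (rule closure_set_plus_subset)
  finally have "closure (T + K) \<subseteq> closure (R + K)"
    by (simp add: add.assoc add_eq closure_minimal)
  then show ?thesis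
    using \<open>S \<sqsubseteq> T\<close> unfolding below_def by blast
qed

lemma below_add: "S \<sqsubseteq> T \<Longrightarrow> S' \<sqsubseteq> T' \<Longrightarrow> S + S' \<sqsubseteq> T + T'"
proof -
  assume "S \<sqsubseteq> T" "S' \<sqsubseteq> T'"
  then have "S + S' \<subseteq> closure (T + K) + closure (T' + K)"
    unfolding below_def by (rule set_plus_mono2)
  also have "\<dots> \<subseteq> closure ((T + K) + (T' + K))"
    by (rule closure_set_plus_subset)
  also have "(T + K) + (T' + K) = T + T' + (K + K)"
    by (simp add: ac_simps)
  finally show ?thesis
    by (simp add: below_def add_eq)
qed

lemma below_sum: "(\<And>i. i \<in> I \<Longrightarrow> S i \<sqsubseteq> T i) \<Longrightarrow> (\<Sum>i\<in>I. S i) \<sqsubseteq> (\<Sum>i\<in>I. T i)"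
  by (induction I rule: infinite_finite_induct) (simp_all add: below_refl below_add)

lemma below_scale: "0 \<le> c \<Longrightarrow> S \<sqsubseteq> T \<Longrightarrow> c *\<^sub>S S \<sqsubseteq> c *\<^sub>S T"
proof -
  assume "0 \<le> c" "S \<sqsubseteq> T"
  then have "c *\<^sub>S S \<subseteq> c *\<^sub>S closure (T + K)"
    unfolding below_def by (intro image_mono)
  also have "\<dots> \<subseteq> closure (c *\<^sub>S (T + K))"
    by (rule scale_set_closure_subset)
  also have "\<dots> \<subseteq> closure (c *\<^sub>S T + K)"
    unfolding scale_set_plus using \<open>0 \<le> c\<close>
    by (intro closure_mono set_plus_mono2 scale_subset order_refl)
  finally show ?thesis
    by (simp add: below_def)
qed

text \<open>Arbitrarily small slack disappears because the right-hand side of \<open>below\<close>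
  is already a closure.\<close>

lemma below_limit:
  assumes "\<And>W. open W \<Longrightarrow> 0 \<in> W \<Longrightarrow> S \<sqsubseteq> T + W"
  shows "S \<sqsubseteq> T"
  unfolding below_def
proof
  fix x assume "x \<in> S"
  show "x \<in> closure (T + K)"
    unfolding closure_iff_nhds_not_empty
  proof (intro allI impI)
    fix P N assume "N \<subseteq> P" "open N" "x \<in> N"
    \<comment> \<open>Continuity of subtraction splits \<open>N\<close>: \<open>V\<close> bounds the
      error of approximating \<open>x\<close> in the closure, and \<open>V'\<close> the slack that
      is subtracted again.\<close>
    have "open ((\<lambda>p. x + (fst p - snd p)) -` N)"
      using \<open>open N\<close> by (intro open_vimage continuous_intros)
    moreover have "(0, 0) \<in> (\<lambda>p. x + (fst p - snd p)) -` N"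
      using \<open>x \<in> N\<close> by simp
    ultimately obtain V V' where "open V" "open V'" "(0, 0) \<in> V \<times> V'"
      and VN: "V \<times> V' \<subseteq> (\<lambda>p. x + (fst p - snd p)) -` N"
      by (rule open_prod_elim)
    then have V: "open V" "open V'" "0 \<in> V" "0 \<in> V'"
      by simp_all
    have "open ((\<lambda>z. z - x) -` V)"
      using V(1) by (intro open_vimage continuous_intros)
    moreover have "x \<in> (\<lambda>z. z - x) -` V"
      using V(3) by simp
    moreover have "x \<in> closure (T + V' + K)"
      using assms[OF V(2,4)] \<open>x \<in> S\<close> unfolding below_def by blast
    ultimately have "(T + V' + K) \<inter> (\<lambda>z. z - x) -` V \<noteq> {}"
      unfolding closure_iff_nhds_not_empty by blast
    then obtain a v k where "a \<in> T" "v \<in> V'" "k \<in> K" "a + v + k - x \<in> V"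
      by (auto elim!: set_plus_elim)
    moreover from this have "x + ((a + v + k - x) - v) \<in> N"
      using VN by fastforce
    ultimately have "a + k \<in> N" "a + k \<in> T + K"
      by (auto simp: add_ac(1) intro: set_plus_intro)
    then show "(T + K) \<inter> P \<noteq> {}"
      using \<open>N \<subseteq> P\<close> by blast
  qed
qed

section \<open>Starshaped and convex sets in terms of \<open>below\<close>\<close>

text \<open>The parameter 0 in the definition of starshapedness collapses a nonempty
  \<open>S\<close> to the singleton of zero.\<close>

lemma closedly_starshaped_zero_below:
  assumes "closedly_starshaped K S" "S \<noteq> {}"
  shows "0 \<sqsubseteq> S"
  using assms unfolding closedly_starshaped_def closedly_starshaped_wrt_def below_def
  by (auto simp: image_constant_conv dest!: bspec[of _ _ 0])

lemma closedly_starshaped_scale_below: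
  assumes "closedly_starshaped K S" "0 \<le> c" "c \<le> 1"
  shows "c *\<^sub>S S \<sqsubseteq> S"
  using assms unfolding closedly_starshaped_def closedly_starshaped_wrt_def below_def
  by auto

lemma zero_below_scale:
  assumes "closedly_starshaped K S" "S \<noteq> {}" "0 \<le> c"
  shows "0 \<sqsubseteq> c *\<^sub>S S"
  using below_scale[OF assms(3) closedly_starshaped_zero_below[OF assms(1,2)]]
  by (simp add: scale_set_zero)

lemma sum_below_superset:
  assumes "finite J" "I \<subseteq> J" "\<And>i. i \<in> J - I \<Longrightarrow> 0 \<sqsubseteq> S i"
  shows "(\<Sum>i\<in>I. S i) \<sqsubseteq> (\<Sum>i\<in>J. S i)"
proof -
  have "(\<Sum>i\<in>I. S i) + 0 \<sqsubseteq> (\<Sum>i\<in>I. S i) + (\<Sum>i\<in>J - I. S i)"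
    using below_sum[of "J - I" "\<lambda>_. 0" S] assms(3)
    by (intro below_add below_refl) (simp del: set_zero)
  then show ?thesis
    using sum.subset_diff[OF assms(2,1), of S] by (simp add: add.commute)
qed

text \<open>Dividing by \<open>a + b\<close> gives convex weights; if \<open>a + b\<close> vanishes,
  both factors do.\<close>

lemma closedly_convex_scale_below:
  assumes "closedly_convex K S" "0 \<le> a" "0 \<le> b"
  shows "a *\<^sub>S S + b *\<^sub>S S \<sqsubseteq> (a + b) *\<^sub>S S"
proof (cases "a + b = 0")
  case True
  then have "a = 0" "b = 0"
    using assms by auto
  then show ?thesis
    by (intro below_subset) (auto elim!: set_plus_elim)
next
  case False
  define r where "r = a / (a + b)"
  have r: "r \<in> {0..1}" "(a + b) * r = a" "(a + b) * (1 - r) = b"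
    using assms False by (auto simp: r_def field_simps)
  have "r *\<^sub>S S + (1 - r) *\<^sub>S S \<sqsubseteq> S"
    using assms(1) r(1) unfolding closedly_convex_def below_def by blast
  then have "(a + b) *\<^sub>S (r *\<^sub>S S + (1 - r) *\<^sub>S S) \<sqsubseteq> (a + b) *\<^sub>S S"
    using assms by (intro below_scale) auto
  then show ?thesis
    by (simp add: scale_set_plus scale_set_scale_set r)
qed

section \<open>Asymptotic inclusion of sequences of sets\<close>

text \<open>The slack \<open>W\<close> lets each term of a finite sum pass to the limit separately.
  Such relations can be chained and added, and \<open>asymp_below_const\<close> removes the slack at
  the end.\<close>

definition asymp_below :: "(nat \<Rightarrow> 'a set) \<Rightarrow> (nat \<Rightarrow> 'a set) \<Rightarrow> bool"
  where "asymp_below S T \<longleftrightarrow>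
    (\<forall>W. open W \<and> 0 \<in> W \<longrightarrow> (\<forall>\<^sub>F j in sequentially. S j \<sqsubseteq> T j + W))"

lemma asymp_belowD:
  "asymp_below S T \<Longrightarrow> open W \<Longrightarrow> 0 \<in> W \<Longrightarrow> \<forall>\<^sub>F j in sequentially. S j \<sqsubseteq> T j + W"
  by (simp add: asymp_below_def)

lemma asymp_below_eventually:
  assumes "\<forall>\<^sub>F j in sequentially. S j \<sqsubseteq> T j"
  shows "asymp_below S T"
  unfolding asymp_below_def
proof (intro allI impI)
  fix W :: "'a set" assume "open W \<and> 0 \<in> W"
  then have "T j \<subseteq> T j + W" for j
    using set_zero_plus2[of W "T j"] by (simp add: add.commute)
  with assms show "\<forall>\<^sub>F j in sequentially. S j \<sqsubseteq> T j + W"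
    by (elim eventually_mono) (rule below_trans[OF _ below_subset])
qed

lemma asymp_below_trans [trans]:
  assumes "asymp_below S T" "asymp_below T R"
  shows "asymp_below S R"
  unfolding asymp_below_def
proof (intro allI impI)
  fix W :: "'a set" assume "open W \<and> 0 \<in> W"
  then obtain V where V: "open V" "0 \<in> V" "V + V \<subseteq> W"
    using half_nhd by blast
  show "\<forall>\<^sub>F j in sequentially. S j \<sqsubseteq> R j + W"
    using asymp_belowD[OF assms(1) V(1,2)] asymp_belowD[OF assms(2) V(1,2)]
  proof eventually_elim
    case (elim j)
    have "S j \<sqsubseteq> T j + V"
      by fact
    also have "\<dots> \<sqsubseteq> R j + V + V"
      by (intro below_add below_refl elim)
    also have "\<dots> \<sqsubseteq> R j + W"
      unfolding add.assoc using V by (intro below_subset set_plus_mono2) auto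
    finally show ?case .
  qed
qed

lemma asymp_below_add:
  assumes "asymp_below S T" "asymp_below S' T'"
  shows "asymp_below (\<lambda>j. S j + S' j) (\<lambda>j. T j + T' j)"
  unfolding asymp_below_def
proof (intro allI impI)
  fix W :: "'a set" assume "open W \<and> 0 \<in> W"
  then obtain V where V: "open V" "0 \<in> V" "V + V \<subseteq> W"
    using half_nhd by blast
  show "\<forall>\<^sub>F j in sequentially. S j + S' j \<sqsubseteq> T j + T' j + W"
    using asymp_belowD[OF assms(1) V(1,2)] asymp_belowD[OF assms(2) V(1,2)]
  proof eventually_elim
    case (elim j)
    have "S j + S' j \<sqsubseteq> (T j + V) + (T' j + V)"
      by (intro below_add elim)
    also have "\<dots> = T j + T' j + (V + V)"
      by (simp add: ac_simps)
    also have "\<dots> \<sqsubseteq> T j + T' j + W"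
      using V by (intro below_subset set_plus_mono2) auto
    finally show ?case .
  qed
qed

lemma asymp_below_sum:
  "(\<And>i. i \<in> I \<Longrightarrow> asymp_below (\<lambda>j. S j i) (\<lambda>j. T j i)) \<Longrightarrow>
    asymp_below (\<lambda>j. \<Sum>i\<in>I. S j i) (\<lambda>j. \<Sum>i\<in>I. T j i)"
  by (induction I rule: infinite_finite_induct)
    (simp_all add: asymp_below_eventually below_refl asymp_below_add)

lemma asymp_below_const: "asymp_below (\<lambda>_. S) (\<lambda>_. T) \<Longrightarrow> S \<sqsubseteq> T"
  by (rule below_limit) (simp add: asymp_below_def)

text \<open>
  A larger factor is absorbed by lower boundedness, a smaller one by starshapedness.
\<close>

lemma asymp_below_scale:
  assumes "balanced_nhds_base \<U>" "closedly_starshaped_wrt K y S" "closedly_lower_bounded \<U> K S"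
    and nonneg: "\<And>j. 0 \<le> c j" "\<And>j. 0 \<le> d j"
    and lim: "(\<lambda>j. c j - d j) \<longlonglongrightarrow> 0"
  shows "asymp_below (\<lambda>j. c j *\<^sub>S S) (\<lambda>j. d j *\<^sub>S S)"
  unfolding asymp_below_def
proof (intro allI impI)
  fix W :: "'a set" assume W: "open W \<and> 0 \<in> W"
  obtain H where H: "tvs_bounded \<U> H" "S \<sqsubseteq> H"
    using assms(3) unfolding closedly_lower_bounded_def below_def by blast
  have "\<forall>\<^sub>F j in sequentially. (c j - d j) *\<^sub>S H \<subseteq> W"
    using W by (intro tvs_bounded_eventually[OF assms(1) H(1) lim]) auto
  moreover have "\<forall>\<^sub>F j in sequentially. (c j - d j) *\<^sub>R y \<in> W"
    using W by (intro eventually_scaleR_mem[OF lim]) auto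
  ultimately show "\<forall>\<^sub>F j in sequentially. c j *\<^sub>S S \<sqsubseteq> d j *\<^sub>S S + W"
  proof eventually_elim
    case (elim j)
    show ?case
    proof (cases "d j \<le> c j")
      case True
      have "c j *\<^sub>S S \<sqsubseteq> d j *\<^sub>S S + (c j - d j) *\<^sub>S S"
        using scale_set_add_subset[of "d j" "c j - d j" S] by (intro below_subset) simp
      also have "\<dots> \<sqsubseteq> d j *\<^sub>S S + (c j - d j) *\<^sub>S H"
        using True by (intro below_add below_refl below_scale H) simp
      also have "\<dots> \<sqsubseteq> d j *\<^sub>S S + W"
        using elim by (intro below_subset set_plus_mono2) auto
      finally show ?thesis .
    next
      case False
      \<comment> \<open>Here \<open>d j\<close> is positive, as it exceeds the nonnegative
        \<open>c j\<close>.\<close>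
      define r where "r = c j / d j"
      have r: "r \<in> {0..1}" "d j * r = c j"
        using False nonneg(1)[of j] by (auto simp: r_def)
      have "r *\<^sub>S S + {(1 - r) *\<^sub>R y} \<sqsubseteq> S"
        using assms(2) r(1) unfolding closedly_starshaped_wrt_def below_def by blast
      then have "d j *\<^sub>S (r *\<^sub>S S + {(1 - r) *\<^sub>R y}) \<sqsubseteq> d j *\<^sub>S S"
        using nonneg by (intro below_scale)
      then have "c j *\<^sub>S S + {(d j - c j) *\<^sub>R y} \<sqsubseteq> d j *\<^sub>S S"
        by (simp add: scale_set_plus scale_set_scale_set r right_diff_distrib)
      \<comment> \<open>Starshapedness with respect to \<open>y\<close> shifts the set by
        \<open>(d j - c j)\<close> times \<open>y\<close>. The opposite shift lies in
        \<open>W\<close>, so it can be added on both sides.\<close>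
      then have "c j *\<^sub>S S + {(d j - c j) *\<^sub>R y} + {(c j - d j) *\<^sub>R y} \<sqsubseteq> d j *\<^sub>S S + W"
        using elim by (intro below_add[OF _ below_subset]) auto
      moreover have "{(d j - c j) *\<^sub>R y} + {(c j - d j) *\<^sub>R y} = 0"
        by (simp add: set_plus_def flip: scaleR_add_left)
      ultimately show ?thesis
        by (simp add: add.assoc)
    qed
  qed
qed

end

section \<open>The closed recession cone as an instance of the locale\<close>

lemma recession_cone_add:
  assumes "y \<in> recession_cone S" "z \<in> recession_cone S"
  shows "y + z \<in> recession_cone S"
proof -
  have "{t *\<^sub>R (y + z)} + S \<subseteq> S" if "t \<ge> 0" for t
  proof -
    have "{t *\<^sub>R (y + z)} = {t *\<^sub>R y} + {t *\<^sub>R z}"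
      by (simp add: scaleR_add_right set_plus_def)
    then have "{t *\<^sub>R (y + z)} + S = {t *\<^sub>R y} + ({t *\<^sub>R z} + S)"
      by (simp only: add.assoc)
    also have "\<dots> \<subseteq> {t *\<^sub>R y} + S"
      using assms(2) that unfolding recession_cone_def by (intro set_plus_mono2) auto
    also have "\<dots> \<subseteq> S"
      using assms(1) that unfolding recession_cone_def by blast
    finally show ?thesis .
  qed
  then show ?thesis
    by (simp add: recession_cone_def)
qed

lemma recession_cone_scaleR: "y \<in> recession_cone S \<Longrightarrow> 0 \<le> c \<Longrightarrow> c *\<^sub>R y \<in> recession_cone S"
  by (simp add: recession_cone_def)

text \<open>The cone axioms hold for each recession cone, hence for their intersection, and pass to
  the closure by continuity of addition and scaling.\<close>

lemma nonneg_cone_closure_recession_cone_map: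
  fixes B :: "'x \<Rightarrow> 'a::real_hausdorff_tvs set"
  shows "nonneg_cone (closure (recession_cone_map E B))" (is "nonneg_cone (closure ?R)")
proof
  have "0 \<in> ?R"
    by (auto simp: recession_cone_map_def recession_cone_def set_plus_def)
  then show "0 \<in> closure ?R"
    using closure_subset by blast
  have "?R + ?R \<subseteq> ?R"
    by (auto simp: recession_cone_map_def elim!: set_plus_elim intro: recession_cone_add)
  then show "closure ?R + closure ?R \<subseteq> closure ?R"
    using closure_set_plus_subset closure_mono by blast
  show "c *\<^sub>S closure ?R \<subseteq> closure ?R" if "0 \<le> c" for c
  proof -
    have "c *\<^sub>S ?R \<subseteq> ?R"
      using that by (auto simp: recession_cone_map_def intro: recession_cone_scaleR)
    then show ?thesis
      using scale_set_closure_subset closure_mono by blast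
  qed
qed

section \<open>The distance to the integers\<close>

lemma dist_Ints_bdd_below: "bdd_below (range (\<lambda>k::int. \<bar>of_int k - t\<bar> :: real))"
  by (rule bdd_belowI[of _ 0]) auto

lemma dist_Ints_le: "dist_Ints t \<le> \<bar>of_int k - t\<bar>"
  unfolding dist_Ints_def by (rule cINF_lower[OF dist_Ints_bdd_below]) simp

lemma dist_Ints_nonneg: "0 \<le> dist_Ints t"
  unfolding dist_Ints_def by (rule cINF_greatest) auto

lemma dist_Ints_of_int: "dist_Ints (of_int k) = 0"
  using dist_Ints_le[of "of_int k" k] dist_Ints_nonneg[of "of_int k"] by simp

lemma dist_Ints_le_half: "dist_Ints t \<le> 1 / 2"
  using dist_Ints_le[of t "round t"] of_int_round_abs_le[of t] by linarith

text \<open>An infimum of 1-Lipschitz functions is 1-Lipschitz.\<close>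

lemma dist_Ints_lipschitz: "\<bar>dist_Ints s - dist_Ints t\<bar> \<le> \<bar>s - t\<bar>"
proof -
  have "dist_Ints a - \<bar>a - b\<bar> \<le> dist_Ints b" for a b
    unfolding dist_Ints_def[of b]
  proof (rule cINF_greatest)
    fix k :: int
    show "dist_Ints a - \<bar>a - b\<bar> \<le> \<bar>of_int k - b\<bar>"
      using dist_Ints_le[of a k] by linarith
  qed simp
  from this[of s t] this[of t s] show ?thesis
    by linarith
qed

lemma dist_Ints_tendsto: "(f \<longlongrightarrow> l) G \<Longrightarrow> ((\<lambda>x. dist_Ints (f x)) \<longlongrightarrow> dist_Ints l) G"
  by (erule tendsto_dist_iff[THEN iffD2, OF Lim_null_comparison[rotated], OF tendsto_dist_iff[THEN iffD1]])
    (simp add: dist_real_def dist_Ints_lipschitz)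

text \<open>Any other integer is at distance at least 1 from \<open>k\<close>, hence at least 1/2
  from \<open>t\<close>.\<close>

lemma dist_Ints_near: "\<bar>of_int k - t\<bar> \<le> 1 / 2 \<Longrightarrow> dist_Ints t = \<bar>of_int k - t\<bar>"
proof (rule antisym[OF dist_Ints_le])
  assume k: "\<bar>of_int k - t\<bar> \<le> 1 / 2"
  show "\<bar>of_int k - t\<bar> \<le> dist_Ints t"
    unfolding dist_Ints_def
  proof (rule cINF_greatest)
    fix i :: int
    show "\<bar>of_int k - t\<bar> \<le> \<bar>of_int i - t\<bar>"
    proof (cases "i = k")
      case False
      then have "1 \<le> \<bar>of_int i - of_int k :: real\<bar>"
        by linarith
      then show ?thesis
        using k by linarith
    qed simp
  qed simp
qed

lemma dist_Ints_half_odd: "odd m \<Longrightarrow> dist_Ints (of_int m / 2) = 1 / 2"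
  by (elim oddE, subst dist_Ints_near[of "m div 2"]) (auto simp: field_simps)

text \<open>The function is affine on each interval from \<open>q / 2\<close> to
  \<open>(q + 1) / 2\<close>: one endpoint is an integer, and it is a nearest integer to every point
  of the interval.\<close>

lemma dist_Ints_midpoint:
  assumes "of_int q \<le> 2 * a" "2 * a \<le> of_int q + 1" "of_int q \<le> 2 * b" "2 * b \<le> of_int q + 1"
  shows "2 * dist_Ints ((a + b) / 2) = dist_Ints a + dist_Ints b"
proof (cases "even q")
  case True
  then obtain i where "q = 2 * i" ..
  then have "dist_Ints c = \<bar>of_int i - c\<bar>" if "c \<in> {a, b, (a + b) / 2}" for c
    using assms that by (intro dist_Ints_near) (auto simp: abs_if field_simps)
  then show ?thesis
    using assms \<open>q = 2 * i\<close> by (simp add: abs_if field_simps)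
next
  case False
  then obtain i where "q = 2 * i + 1" ..
  then have "dist_Ints c = \<bar>of_int (i + 1) - c\<bar>" if "c \<in> {a, b, (a + b) / 2}" for c
    using assms that by (intro dist_Ints_near) (auto simp: abs_if field_simps)
  then show ?thesis
    using assms \<open>q = 2 * i + 1\<close> by (simp add: abs_if field_simps)
qed

lemma dist_Ints_dyadic_midpoint:
  fixes i n k :: nat
  assumes "k < n"
  shows "2 * dist_Ints (2 ^ k * ((2 * real i + 1) / 2 ^ Suc n)) =
    dist_Ints (2 ^ k * (real i / 2 ^ n)) + dist_Ints (2 ^ k * (real (Suc i) / 2 ^ n))"
proof -
  \<comment> \<open>After multiplication by \<open>2 ^ k\<close>, the grid of level \<open>n\<close>
    has step \<open>1 / (2 * M)\<close>, so a half-integer interval consists of \<open>M\<close>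
    steps; \<open>q\<close> numbers the one that contains both neighbours.\<close>
  define M :: nat where "M = 2 ^ (n - Suc k)"
  define q where "q = i div M"
  have M: "M > 0"
    by (simp add: M_def)
  have "(2::real) ^ n = 2 ^ (k + Suc (n - Suc k))"
    using assms by simp
  then have n: "(2::real) ^ n = 2 ^ k * 2 * real M"
    by (simp add: M_def power_add)
  have "q * M \<le> i" "Suc i \<le> Suc q * M"
    using M dividend_less_div_times[of M i] by (auto simp: q_def)
  then have q: "real q * real M \<le> real i" "real i + 1 \<le> (real q + 1) * real M"
    by (metis of_nat_le_iff of_nat_mult) (metis \<open>Suc i \<le> Suc q * M\<close> of_nat_le_iff of_nat_mult of_nat_Suc add.commute)
  have scaled: "2 ^ k * x / 2 ^ n = x / (2 * real M)" for x :: real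
    by (simp add: n)
  have "2 * dist_Ints ((2 ^ k * (real i / 2 ^ n) + 2 ^ k * (real (Suc i) / 2 ^ n)) / 2) =
    dist_Ints (2 ^ k * (real i / 2 ^ n)) + dist_Ints (2 ^ k * (real (Suc i) / 2 ^ n))"
    using q M by (intro dist_Ints_midpoint[of "int q"]) (simp_all add: scaled pos_le_divide_eq pos_divide_le_eq)
  moreover have "(2 ^ k * (real i / 2 ^ n) + 2 ^ k * (real (Suc i) / 2 ^ n)) / 2 =
      2 ^ k * ((2 * real i + 1) / 2 ^ Suc n)"
    by (simp add: field_simps)
  ultimately show ?thesis
    by (simp only:)
qed

section \<open>The inequality at dyadic points\<close>

lemma diff_set_scaleR:
  assumes "convex D" "u \<in> diff_set D" "0 \<le> c" "c \<le> 1"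
  shows "c *\<^sub>R u \<in> diff_set D"
proof -
  obtain x y where xy: "u = x - y" "x \<in> D" "y \<in> D"
    using assms(2) unfolding diff_set_def by blast
  then have "c *\<^sub>R x + (1 - c) *\<^sub>R y \<in> D"
    using assms by (intro convexD) auto
  moreover have "c *\<^sub>R u = (c *\<^sub>R x + (1 - c) *\<^sub>R y) - y"
    by (simp add: xy algebra_simps)
  ultimately show ?thesis
    using xy(3) unfolding diff_set_def by blast
qed

lemma diff_set_divide_power:
  assumes "convex D" "u \<in> diff_set D"
  shows "u /\<^sub>R 2 ^ k \<in> diff_set D"
  using assms by (intro diff_set_scaleR) (auto simp: field_simps)

text \<open>Neighbouring points of level \<open>n\<close> on the segment differ by exactly
  \<open>(x - y) /\<^sub>R 2 ^ n\<close>. Applying \<open>Jensen\<close> to them therefore produces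
  the summand with index \<open>n\<close> that the next level adds.\<close>

lemma (in nonneg_cone) Jensen_dyadic:
  fixes F A B :: "'x::real_vector \<Rightarrow> 'a set"
  assumes "convex D"
    and nonempty_A: "\<And>u. u \<in> diff_set D \<Longrightarrow> A u \<noteq> {}"
    and nonempty_B: "\<And>u. u \<in> diff_set D \<Longrightarrow> B u \<noteq> {}"
    and Jensen: "\<And>x y. x \<in> D \<Longrightarrow> y \<in> D \<Longrightarrow>
      (1/2) *\<^sub>S (F x + F y) + A (x - y) \<sqsubseteq> F ((1/2) *\<^sub>R (x + y)) + B (x - y)"
    and B_convex: "\<And>u. u \<in> diff_set D \<Longrightarrow> closedly_convex K (B u)"
    and xy: "x \<in> D" "y \<in> D"
    and "m \<le> 2 ^ n" "t = real m / 2 ^ n"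
  shows "t *\<^sub>S F x + (1 - t) *\<^sub>S F y +
      (\<Sum>k<n. (2 * dist_Ints (2 ^ k * t)) *\<^sub>S A ((x - y) /\<^sub>R 2 ^ k))
    \<sqsubseteq> F (t *\<^sub>R x + (1 - t) *\<^sub>R y) +
      (\<Sum>k<n. (2 * dist_Ints (2 ^ k * t)) *\<^sub>S B ((x - y) /\<^sub>R 2 ^ k))"
  using assms(8,9)
proof (induction n arbitrary: m t)
  case 0
  then have "t = 0 \<or> t = 1"
    by (cases m) auto
  then show ?case
    by (intro below_subset) (auto elim!: set_plus_elim)
next
  case (Suc n)
  define u where "u = x - y"
  define w where "w = (\<lambda>k s. 2 * dist_Ints (2 ^ k * s))"
  define SA where "SA = (\<lambda>s. \<Sum>k<n. w k s *\<^sub>S A (u /\<^sub>R 2 ^ k))"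
  define SB where "SB = (\<lambda>s. \<Sum>k<n. w k s *\<^sub>S B (u /\<^sub>R 2 ^ k))"
  define L where "L = (\<lambda>s. s *\<^sub>S F x + (1 - s) *\<^sub>S F y)"
  define P where "P = (\<lambda>s. s *\<^sub>R x + (1 - s) *\<^sub>R y)"
  have u: "u /\<^sub>R 2 ^ k \<in> diff_set D" for k
    using xy \<open>convex D\<close> by (intro diff_set_divide_power) (auto simp: u_def diff_set_def)
  have IH: "L s + SA s \<sqsubseteq> F (P s) + SB s" if "i \<le> 2 ^ n" "s = real i / 2 ^ n" for i s
    using Suc.IH[OF that] by (simp add: L_def P_def SA_def SB_def w_def u_def)
  \<comment> \<open>The new weight is twice the distance of \<open>m / 2\<close> to the integers: 0
    for even \<open>m\<close> and 1 for odd \<open>m\<close>.\<close>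
  have "L t + (SA t + w n t *\<^sub>S A (u /\<^sub>R 2 ^ n)) \<sqsubseteq> F (P t) + (SB t + w n t *\<^sub>S B (u /\<^sub>R 2 ^ n))"
  proof (cases "even m")
    case True
    then obtain i where i: "m = 2 * i" ..
    then have "t = real i / 2 ^ n" "i \<le> 2 ^ n"
      using Suc.prems by simp_all
    moreover from this have "w n t = 0"
      using dist_Ints_of_int[of "int i"] by (simp add: w_def)
    \<comment> \<open>The sets with factor 0 collapse to the zero singleton because the values of
      \<open>A\<close> and \<open>B\<close> are nonempty.\<close>
    ultimately show ?thesis
      using IH[of i t] by (simp add: image_constant_conv nonempty_A nonempty_B u)
  next
    case False
    then obtain i where i: "m = 2 * i + 1" ..
    define a where "a = real i / 2 ^ n"
    define b where "b = real (Suc i) / 2 ^ n"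
    have t: "t = (2 * real i + 1) / 2 ^ Suc n"
      using Suc.prems i by simp
    have i_le: "i \<le> 2 ^ n" "Suc i \<le> 2 ^ n"
      using Suc.prems i by simp_all
    then have "real i \<le> 2 ^ n" "real (Suc i) \<le> 2 ^ n"
      by (metis of_nat_le_iff of_nat_numeral of_nat_power)+
    then have ab: "0 \<le> a" "a \<le> 1" "0 \<le> b" "b \<le> 1"
      by (auto simp: a_def b_def)
    have t_ab: "t = a / 2 + b / 2"
      by (simp add: t a_def b_def field_simps)
    have w_ab: "w k t = w k a / 2 + w k b / 2" if "k < n" for k
      using dist_Ints_dyadic_midpoint[OF that, of i] by (simp add: w_def a_def b_def t)
    have w_nonneg: "0 \<le> w k s" for k s
      by (simp add: w_def dist_Ints_nonneg)
    have half_odd: "2 ^ n * t = of_int (int m) / 2"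
      by (simp add: t i)
    have w_n: "w n t = 1"
      using dist_Ints_half_odd[of "int m"] False unfolding w_def half_odd by simp
    have "P s \<in> D" if "0 \<le> s" "s \<le> 1" for s
      unfolding P_def using xy that by (intro convexD[OF \<open>convex D\<close>]) simp_all
    then have P_ab: "P a \<in> D" "P b \<in> D"
      using ab by blast+
    \<comment> \<open>The larger parameter \<open>b\<close> is nearer to \<open>x\<close>. Taking
      the neighbours in the order \<open>P b\<close>, \<open>P a\<close> gives their difference the
      sign of \<open>u\<close>.\<close>
    have "b - a = inverse (2 ^ n)"
      by (simp add: a_def b_def field_simps)
    moreover have "P b - P a = (b - a) *\<^sub>R u"
      by (simp add: P_def u_def algebra_simps)
    ultimately have P_diff: "P b - P a = u /\<^sub>R 2 ^ n"
      by simp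
    have "P b + P a = (b + a) *\<^sub>R x + ((1 - b) + (1 - a)) *\<^sub>R y"
      by (simp only: P_def scaleR_add_left ac_simps)
    moreover have "1/2 * (b + a) = t" "1/2 * ((1 - b) + (1 - a)) = 1 - t"
      by (simp_all add: t_ab field_simps)
    ultimately have P_mid: "(1/2) *\<^sub>R (P b + P a) = P t"
      by (simp only: P_def scaleR_add_right scaleR_scaleR)
    have half_L: "(1/2) *\<^sub>S L s = (s / 2) *\<^sub>S F x + ((1 - s) / 2) *\<^sub>S F y" for s
      by (simp add: L_def scale_set_plus scale_set_scale_set)
    have t': "1 - t = (1 - a) / 2 + (1 - b) / 2"
      by (simp add: t_ab field_simps)
    \<comment> \<open>Averaging on the left, here and for \<open>SA\<close>, splits a factor into
      two, which is possible for arbitrary sets.\<close>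
    have L_subset: "L t \<subseteq> (1/2) *\<^sub>S L a + (1/2) *\<^sub>S L b"
    proof -
      have "L t \<subseteq> ((a / 2) *\<^sub>S F x + (b / 2) *\<^sub>S F x) +
          (((1 - a) / 2) *\<^sub>S F y + ((1 - b) / 2) *\<^sub>S F y)"
        unfolding L_def t' unfolding t_ab by (intro set_plus_mono2 scale_set_add_subset)
      then show ?thesis
        unfolding half_L by (simp only: add_ac)
    qed
    have SA_below: "SA t \<sqsubseteq> (1/2) *\<^sub>S SA a + (1/2) *\<^sub>S SA b"
      unfolding SA_def scale_set_sum sum.distrib[symmetric] scale_set_scale_set
      using w_ab scale_set_add_subset by (intro below_sum below_subset) simp
    have "L t + (SA t + A (u /\<^sub>R 2 ^ n))
      \<sqsubseteq> ((1/2) *\<^sub>S L a + (1/2) *\<^sub>S L b) + (((1/2) *\<^sub>S SA a + (1/2) *\<^sub>S SA b) + A (u /\<^sub>R 2 ^ n))"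
      by (intro below_add below_refl below_subset[OF L_subset] SA_below)
    also have "\<dots> = (1/2) *\<^sub>S (L a + SA a) + (1/2) *\<^sub>S (L b + SA b) + A (u /\<^sub>R 2 ^ n)"
      by (simp only: scale_set_plus add_ac)
    also have "\<dots> \<sqsubseteq> (1/2) *\<^sub>S (F (P a) + SB a) + (1/2) *\<^sub>S (F (P b) + SB b) + A (u /\<^sub>R 2 ^ n)"
      using IH[OF i_le(1) a_def] IH[OF i_le(2) b_def]
      by (intro below_add[OF below_add[OF below_scale below_scale] below_refl]) simp_all
    also have "\<dots> = ((1/2) *\<^sub>S (F (P b) + F (P a)) + A (P b - P a)) + ((1/2) *\<^sub>S SB a + (1/2) *\<^sub>S SB b)"
      by (simp only: P_diff scale_set_plus add_ac)
    also have "\<dots> \<sqsubseteq> (F (P t) + B (u /\<^sub>R 2 ^ n)) + SB t"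
    proof (rule below_add)
      show "(1/2) *\<^sub>S (F (P b) + F (P a)) + A (P b - P a) \<sqsubseteq> F (P t) + B (u /\<^sub>R 2 ^ n)"
        using Jensen[OF P_ab(2,1)] by (simp only: P_mid P_diff)
      \<comment> \<open>On the right two multiples of the same set must be merged into one; this is
        where convexity of the values of \<open>B\<close> enters.\<close>
      show "(1/2) *\<^sub>S SB a + (1/2) *\<^sub>S SB b \<sqsubseteq> SB t"
        unfolding SB_def scale_set_sum sum.distrib[symmetric] scale_set_scale_set
      proof (rule below_sum)
        fix k assume "k \<in> {..<n}"
        then show "(1/2 * w k a) *\<^sub>S B (u /\<^sub>R 2 ^ k) + (1/2 * w k b) *\<^sub>S B (u /\<^sub>R 2 ^ k)
            \<sqsubseteq> w k t *\<^sub>S B (u /\<^sub>R 2 ^ k)"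
          using closedly_convex_scale_below[OF B_convex[OF u], of "w k a / 2" "w k b / 2" k]
          by (simp add: w_ab w_nonneg)
      qed
    qed
    also have "\<dots> = F (P t) + (SB t + B (u /\<^sub>R 2 ^ n))"
      by (simp only: add_ac)
    finally show ?thesis
      by (simp add: w_n)
  qed
  then show ?case
    by (simp add: L_def P_def SA_def SB_def w_def u_def)
qed

section \<open>Passage to the limit\<close>

text \<open>The bound \<open>\<delta>\<close> depends on the direction, so the points must approach
  \<open>p\<close> along the one ray spanned by \<open>h\<close>. The definition speaks of positive
  parameters only, whence the separate case \<open>r j = 0\<close>.\<close>

lemma (in nonneg_cone) directionally_usc_asymp_below:
  assumes "balanced_nhds_base \<U>" "directionally_usc_at \<U> K D F p"
    and "r \<longlonglongrightarrow> 0" "\<And>j. 0 \<le> r j" "\<And>j. p + r j *\<^sub>R h \<in> D"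
  shows "asymp_below (\<lambda>j. F (p + r j *\<^sub>R h)) (\<lambda>_. F p)"
  unfolding asymp_below_def
proof (intro allI impI)
  fix W :: "'a set" assume W: "open W \<and> 0 \<in> W"
  then obtain U where U: "U \<in> \<U>" "U \<subseteq> W"
    using balanced_nhds_baseE[OF assms(1)] by metis
  obtain \<delta> where \<delta>: "\<delta> > 0"
    "\<And>t. 0 < t \<Longrightarrow> t < \<delta> \<Longrightarrow> p + t *\<^sub>R h \<in> D \<Longrightarrow> F (p + t *\<^sub>R h) \<subseteq> F p + U + K"
    using assms(2) U(1) unfolding directionally_usc_at_def by metis
  have "\<forall>\<^sub>F j in sequentially. r j < \<delta>"
    using order_tendstoD(2)[OF assms(3) \<delta>(1)] .
  then show "\<forall>\<^sub>F j in sequentially. F (p + r j *\<^sub>R h) \<sqsubseteq> F p + W"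
  proof eventually_elim
    case (elim j)
    show ?case
    proof (cases "r j = 0")
      case True
      have "F p \<subseteq> F p + W"
        using W set_zero_plus2[of W "F p"] by (simp add: add.commute)
      then show ?thesis
        using True by (simp add: below_subset)
    next
      case False
      then have "0 < r j"
        using assms(4)[of j] by simp
      then have "F (p + r j *\<^sub>R h) \<subseteq> F p + U + K"
        using elim assms(5) by (intro \<delta>) auto
      also have "\<dots> \<subseteq> F p + W + K"
        using U by (intro set_plus_mono2) auto
      finally show ?thesis
        using below_subset below_add_cone below_trans by blast
    qed
  qed
qed

text \<open>
  The head of the sum varies continuously with \<open>s\<^sub>j\<close>; the tail is small, uniformly in \<open>s\<^sub>j\<close>, because
  its factors are at most \<open>1\<close> and can be removed by starshapedness.
\<close>

lemma (in nonneg_cone) partial_sums_asymp_below_tabor: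
  fixes S :: "'x::real_vector \<Rightarrow> 'a set"
  assumes base: "balanced_nhds_base \<U>"
    and nonempty: "\<And>k. S (u /\<^sub>R 2 ^ k) \<noteq> {}"
    and star: "\<And>k. closedly_starshaped K (S (u /\<^sub>R 2 ^ k))"
    and bounded: "\<And>k. closedly_lower_bounded \<U> K (S (u /\<^sub>R 2 ^ k))"
    and Cauchy: "serially_Cauchy \<U> K (\<lambda>k. S (u /\<^sub>R 2 ^ k))"
    and s: "s \<longlonglongrightarrow> t"
  shows "asymp_below (\<lambda>j. \<Sum>k<j. (2 * dist_Ints (2 ^ k * s j)) *\<^sub>S S (u /\<^sub>R 2 ^ k)) (\<lambda>_. tabor S t u)"
  unfolding asymp_below_def
proof (intro allI impI)
  define w where "w = (\<lambda>k s. 2 * dist_Ints (2 ^ k * s))"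
  define T where "T = (\<lambda>k. S (u /\<^sub>R 2 ^ k))"
  have w: "0 \<le> w k a" "w k a \<le> 1" for k a
    using dist_Ints_le_half[of "2 ^ k * a"] by (simp_all add: w_def dist_Ints_nonneg)
  fix W :: "'a set" assume "open W \<and> 0 \<in> W"
  then obtain V where V: "open V" "0 \<in> V" "V + V \<subseteq> W"
    using half_nhd by blast
  obtain U where U: "U \<in> \<U>" "U \<subseteq> V"
    using balanced_nhds_baseE[OF base V(1,2)] by metis
  obtain m where m: "\<And>n. n \<ge> m \<Longrightarrow> (\<Sum>k=m..n. T k) \<subseteq> U + K"
    using Cauchy U(1) unfolding serially_Cauchy_def T_def by metis
  have "asymp_below (\<lambda>j. \<Sum>k<m. w k (s j) *\<^sub>S T k) (\<lambda>_. \<Sum>k<m. w k t *\<^sub>S T k)"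
  proof (rule asymp_below_sum)
    fix k
    have "(\<lambda>j. w k (s j) - w k t) \<longlonglongrightarrow> w k t - w k t"
      unfolding w_def by (intro tendsto_intros dist_Ints_tendsto s)
    then show "asymp_below (\<lambda>j. w k (s j) *\<^sub>S T k) (\<lambda>_. w k t *\<^sub>S T k)"
      using star[of k] bounded[of k] w unfolding T_def closedly_starshaped_def
      by (intro asymp_below_scale[OF base]) auto
  qed
  from asymp_belowD[OF this V(1,2)] eventually_gt_at_top[of m]
  show "\<forall>\<^sub>F j in sequentially.
      (\<Sum>k<j. (2 * dist_Ints (2 ^ k * s j)) *\<^sub>S S (u /\<^sub>R 2 ^ k)) \<sqsubseteq> tabor S t u + W"
  proof eventually_elim
    case (elim j)
    \<comment> \<open>The Cauchy condition bounds blocks with inclusive ends, so the tail is written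
      as \<open>{m..j - 1}\<close>; \<open>j > m\<close> makes \<open>j - 1\<close> an admissible
      upper end.\<close>
    have range_split: "{..<j} = {..<m} \<union> {m..j - 1}"
      using elim(2) by auto
    have "(\<Sum>k<j. w k (s j) *\<^sub>S T k) =
        (\<Sum>k<m. w k (s j) *\<^sub>S T k) + (\<Sum>k=m..j - 1. w k (s j) *\<^sub>S T k)"
      unfolding range_split by (rule sum.union_disjoint) auto
    also have "\<dots> \<sqsubseteq> ((\<Sum>k<m. w k t *\<^sub>S T k) + V) + (\<Sum>k=m..j - 1. T k)"
      using star w unfolding T_def
      by (intro below_add elim(1)[unfolded T_def] below_sum closedly_starshaped_scale_below) auto
    also have "\<dots> \<sqsubseteq> (tabor S t u + V) + V"
    proof (intro below_add below_refl)
      \<comment> \<open>The partial sums in \<open>tabor\<close> include their last index, so the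
        term \<open>k = m\<close> is added; this is allowed since it dominates zero.\<close>
      have "(\<Sum>k<m. w k t *\<^sub>S T k) \<sqsubseteq> (\<Sum>k=0..m. w k t *\<^sub>S T k)"
        using nonempty star w unfolding T_def
        by (intro sum_below_superset zero_below_scale) auto
      also have "\<dots> \<sqsubseteq> tabor S t u"
        unfolding tabor_def w_def T_def
        by (intro below_subset order_trans[OF _ closure_subset] UN_upper) auto
      finally show "(\<Sum>k<m. w k t *\<^sub>S T k) \<sqsubseteq> tabor S t u" .
      have "(\<Sum>k=m..j - 1. T k) \<subseteq> U + K"
        using elim by (intro m) auto
      also have "\<dots> \<subseteq> V + K"
        using U by (intro set_plus_mono2) auto
      finally show "(\<Sum>k=m..j - 1. T k) \<sqsubseteq> V"
        using below_subset below_add_cone below_trans by blast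
    qed
    also have "\<dots> \<sqsubseteq> tabor S t u + W"
      unfolding add.assoc using V by (intro below_subset set_plus_mono2) auto
    finally show ?case
      by (simp add: w_def T_def)
  qed
qed

text \<open>Rounding \<open>2 ^ j * t\<close> down leaves an error of at most
  \<open>1 / 2 ^ j\<close>. It also keeps the approximations below \<open>t\<close>, as the
  one-sided directional semicontinuity of \<open>F\<close> requires.\<close>

lemma dyadic_floor:
  fixes t :: real
  assumes "t \<in> {0..1}"
  obtains m :: "nat \<Rightarrow> nat" where "\<And>j. m j \<le> 2 ^ j" "\<And>j. real (m j) / 2 ^ j \<le> t"
    "(\<lambda>j. real (m j) / 2 ^ j) \<longlonglongrightarrow> t"
proof
  define m where "m = (\<lambda>j::nat. nat \<lfloor>2 ^ j * t\<rfloor>)"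
  have m: "real (m j) \<le> 2 ^ j * t" "2 ^ j * t < real (m j) + 1" for j
    using assms by (auto simp: m_def)
  show le: "real (m j) / 2 ^ j \<le> t" for j
    using m(1)[of j] by (simp add: field_simps)
  show "m j \<le> 2 ^ j" for j
  proof -
    have "real (m j) \<le> 2 ^ j * 1"
      using m(1)[of j] assms by (elim order_trans) (intro mult_left_mono, auto)
    then show ?thesis
      by (metis mult.right_neutral of_nat_le_iff of_nat_numeral of_nat_power)
  qed
  have lower: "t - (1 / 2) ^ j \<le> real (m j) / 2 ^ j" for j
  proof -
    have "t - (1 / 2) ^ j = (2 ^ j * t - 1) / 2 ^ j"
      by (simp add: diff_divide_distrib power_one_over)
    also have "\<dots> \<le> real (m j) / 2 ^ j"
      using m(2)[of j] by (intro divide_right_mono) auto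
    finally show ?thesis .
  qed
  have "(\<lambda>j. t - (1 / 2) ^ j) \<longlonglongrightarrow> t - 0"
    by (intro tendsto_diff tendsto_const LIMSEQ_power_zero) simp
  then show "(\<lambda>j. real (m j) / 2 ^ j) \<longlonglongrightarrow> t"
    unfolding diff_zero
    using tendsto_sandwich[of "\<lambda>j. t - (1 / 2) ^ j" "\<lambda>j. real (m j) / 2 ^ j" sequentially "\<lambda>_. t" t]
    by (simp add: lower le)
qed

theorem theorem1:
  fixes D :: "'x::real_vector set"
    and A B F :: "'x \<Rightarrow> 'y::real_hausdorff_tvs set"
    and \<U> :: "'y set set"
    and K :: "'y set"
  assumes base: "balanced_nhds_base \<U>"
    and D: "D \<noteq> {}" "convex D"
    and nonempty_A: "\<And>u. u \<in> diff_set D \<Longrightarrow> A u \<noteq> {}"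
    and nonempty_B: "\<And>u. u \<in> diff_set D \<Longrightarrow> B u \<noteq> {}"
    and nonempty_F: "\<And>x. x \<in> D \<Longrightarrow> F x \<noteq> {}"
    and K: "K = closure (recession_cone_map (diff_set D) B)"
    and Jensen: "\<And>x y. x \<in> D \<Longrightarrow> y \<in> D \<Longrightarrow>
      (1/2) *\<^sub>S (F x + F y) + A (x - y)
        \<subseteq> closure (F ((1/2) *\<^sub>R (x + y)) + B (x - y))"
    and F_starshaped: "\<And>x. x \<in> D \<Longrightarrow> \<exists>y. closedly_starshaped_wrt K y (F x)"
    and F_lower_bounded: "\<And>x. x \<in> D \<Longrightarrow> closedly_lower_bounded \<U> K (F x)"
    and F_usc: "\<And>p. p \<in> D \<Longrightarrow> directionally_usc_at \<U> K D F p"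
    and A_starshaped: "\<And>u. u \<in> diff_set D \<Longrightarrow> closedly_starshaped K (A u)"
    and A_lower_bounded: "\<And>u. u \<in> diff_set D \<Longrightarrow> closedly_lower_bounded \<U> K (A u)"
    and B_starshaped: "\<And>u. u \<in> diff_set D \<Longrightarrow> closedly_starshaped K (B u)"
    and B_lower_bounded: "\<And>u. u \<in> diff_set D \<Longrightarrow> closedly_lower_bounded \<U> K (B u)"
    and B_convex: "\<And>u. u \<in> diff_set D \<Longrightarrow> closedly_convex K (B u)"
    and A_Cauchy: "\<And>u. u \<in> diff_set D \<Longrightarrow> serially_Cauchy \<U> K (\<lambda>k. A (u /\<^sub>R 2 ^ k))"
    and B_Cauchy: "\<And>u. u \<in> diff_set D \<Longrightarrow> serially_Cauchy \<U> K (\<lambda>k. B (u /\<^sub>R 2 ^ k))"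
  shows "\<forall>x\<in>D. \<forall>y\<in>D. \<forall>t\<in>{0..1}.
    t *\<^sub>S F x + (1 - t) *\<^sub>S F y + tabor A t (x - y)
      \<subseteq> closure (F (t *\<^sub>R x + (1 - t) *\<^sub>R y) + tabor B t (x - y) + K)"
proof (intro ballI)
  interpret nonneg_cone K
    unfolding K by (rule nonneg_cone_closure_recession_cone_map)
  fix x y t assume xy: "x \<in> D" "y \<in> D" and t: "t \<in> {0..1::real}"
  define w where "w = (\<lambda>k s. 2 * dist_Ints (2 ^ k * s))"
  define A' where "A' = (\<lambda>k. A ((x - y) /\<^sub>R 2 ^ k))"
  define B' where "B' = (\<lambda>k. B ((x - y) /\<^sub>R 2 ^ k))"
  define p where "p = t *\<^sub>R x + (1 - t) *\<^sub>R y"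
  have u: "x - y \<in> diff_set D"
    using xy unfolding diff_set_def by blast
  have u_k: "(x - y) /\<^sub>R 2 ^ k \<in> diff_set D" for k
    using D(2) u by (rule diff_set_divide_power)
  have w_nonneg: "0 \<le> w k s" for k s
    by (simp add: w_def dist_Ints_nonneg)
  have star_A: "closedly_starshaped_wrt K 0 (A' k)" for k
    using A_starshaped[OF u_k] by (simp add: A'_def closedly_starshaped_def)
  obtain m where m: "\<And>j. m j \<le> 2 ^ j" "\<And>j. real (m j) / 2 ^ j \<le> t"
    "(\<lambda>j. real (m j) / 2 ^ j) \<longlonglongrightarrow> t"
    using dyadic_floor[OF t] by metis
  define s where "s = (\<lambda>j. real (m j) / 2 ^ j)"
  have s: "s \<longlonglongrightarrow> t" "s j \<le> t" "0 \<le> s j" "s j \<le> 1" for j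
    using m(1)[of j] m(2,3) t by (simp_all add: s_def)
  \<comment> \<open>For fixed \<open>n\<close> the limit in \<open>j\<close> has three stages:
    replace the factors at \<open>t\<close> by those at \<open>s j\<close>, apply the dyadic
    inequality of level \<open>j\<close>, and let \<open>s j\<close> return to \<open>t\<close> on
    the right.\<close>
  have partial: "t *\<^sub>S F x + (1 - t) *\<^sub>S F y + (\<Sum>k=0..n. w k t *\<^sub>S A' k)
      \<sqsubseteq> F p + tabor B t (x - y)" for n
  proof (rule asymp_below_const)
    have "asymp_below (\<lambda>_. t *\<^sub>S F x + (1 - t) *\<^sub>S F y + (\<Sum>k=0..n. w k t *\<^sub>S A' k))
      (\<lambda>j. s j *\<^sub>S F x + (1 - s j) *\<^sub>S F y + (\<Sum>k=0..n. w k (s j) *\<^sub>S A' k))"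
    proof (intro asymp_below_add asymp_below_sum)
      have lim: "(\<lambda>j. t - s j) \<longlonglongrightarrow> t - t"
        by (intro tendsto_intros s)
      obtain a where "closedly_starshaped_wrt K a (F x)"
        using F_starshaped[OF xy(1)] ..
      then show "asymp_below (\<lambda>_. t *\<^sub>S F x) (\<lambda>j. s j *\<^sub>S F x)"
        using lim t s(3) F_lower_bounded[OF xy(1)] by (intro asymp_below_scale[OF base]) auto
      have lim': "(\<lambda>j. (1 - t) - (1 - s j)) \<longlonglongrightarrow> (1 - t) - (1 - t)"
        by (intro tendsto_intros s)
      obtain b where "closedly_starshaped_wrt K b (F y)"
        using F_starshaped[OF xy(2)] ..
      then show "asymp_below (\<lambda>_. (1 - t) *\<^sub>S F y) (\<lambda>j. (1 - s j) *\<^sub>S F y)"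
        using lim' t s(4) F_lower_bounded[OF xy(2)] by (intro asymp_below_scale[OF base]) auto
      fix k
      have "(\<lambda>j. w k t - w k (s j)) \<longlonglongrightarrow> w k t - w k t"
        unfolding w_def by (intro tendsto_intros dist_Ints_tendsto s)
      then show "asymp_below (\<lambda>_. w k t *\<^sub>S A' k) (\<lambda>j. w k (s j) *\<^sub>S A' k)"
        using w_nonneg star_A A_lower_bounded[OF u_k] unfolding A'_def
        by (intro asymp_below_scale[OF base]) auto
    qed
    also have "asymp_below \<dots> (\<lambda>j. F (p + (t - s j) *\<^sub>R (y - x)) + (\<Sum>k<j. w k (s j) *\<^sub>S B' k))"
    proof (rule asymp_below_eventually)
      show "\<forall>\<^sub>F j in sequentially.
          s j *\<^sub>S F x + (1 - s j) *\<^sub>S F y + (\<Sum>k=0..n. w k (s j) *\<^sub>S A' k)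
          \<sqsubseteq> F (p + (t - s j) *\<^sub>R (y - x)) + (\<Sum>k<j. w k (s j) *\<^sub>S B' k)"
        using eventually_gt_at_top[of n]
      proof eventually_elim
        case (elim j)
        \<comment> \<open>The dyadic inequality of level \<open>j\<close> has the indices below
          \<open>j\<close>; since \<open>j > n\<close>, the left sum can be filled up with terms
          that dominate zero.\<close>
        have "(\<Sum>k=0..n. w k (s j) *\<^sub>S A' k) \<sqsubseteq> (\<Sum>k<j. w k (s j) *\<^sub>S A' k)"
          using elim A_starshaped[OF u_k] nonempty_A[OF u_k] w_nonneg unfolding A'_def
          by (intro sum_below_superset zero_below_scale) auto
        then have "s j *\<^sub>S F x + (1 - s j) *\<^sub>S F y + (\<Sum>k=0..n. w k (s j) *\<^sub>S A' k)
            \<sqsubseteq> s j *\<^sub>S F x + (1 - s j) *\<^sub>S F y + (\<Sum>k<j. w k (s j) *\<^sub>S A' k)"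
          by (intro below_add below_refl)
        also have "\<dots> \<sqsubseteq> F (s j *\<^sub>R x + (1 - s j) *\<^sub>R y) + (\<Sum>k<j. w k (s j) *\<^sub>S B' k)"
          unfolding w_def A'_def B'_def
          using nonempty_A nonempty_B Jensen B_convex xy m(1)
          by (intro Jensen_dyadic[OF D(2), of A B F x y "m j"] below_closure) (auto simp: s_def)
        \<comment> \<open>This form exhibits the fixed direction \<open>y - x\<close> and the
          nonnegative parameter \<open>t - s j\<close> for the semicontinuity of
          \<open>F\<close>.\<close>
        also have "s j *\<^sub>R x + (1 - s j) *\<^sub>R y = p + (t - s j) *\<^sub>R (y - x)"
          by (simp add: p_def algebra_simps)
        finally show ?case .
      qed
    qed
    also have "asymp_below \<dots> (\<lambda>_. F p + tabor B t (x - y))"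
    proof (rule asymp_below_add)
      have lim: "(\<lambda>j. t - s j) \<longlonglongrightarrow> t - t"
        by (intro tendsto_intros s)
      have "p \<in> D"
        using xy t D(2) unfolding p_def by (intro convexD) auto
      moreover have "p + (t - s j) *\<^sub>R (y - x) \<in> D" for j
      proof -
        have "p + (t - s j) *\<^sub>R (y - x) = s j *\<^sub>R x + (1 - s j) *\<^sub>R y"
          by (simp add: p_def algebra_simps)
        also have "\<dots> \<in> D"
          using xy s(3,4) D(2) by (intro convexD) auto
        finally show ?thesis .
      qed
      ultimately show "asymp_below (\<lambda>j. F (p + (t - s j) *\<^sub>R (y - x))) (\<lambda>_. F p)"
        using lim s(2) by (intro directionally_usc_asymp_below[OF base F_usc]) auto
      show "asymp_below (\<lambda>j. \<Sum>k<j. w k (s j) *\<^sub>S B' k) (\<lambda>_. tabor B t (x - y))"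
        unfolding w_def B'_def
        using nonempty_B[OF u_k] B_starshaped[OF u_k] B_lower_bounded[OF u_k] B_Cauchy[OF u] s(1)
        by (intro partial_sums_asymp_below_tabor[OF base]) auto
    qed
    finally show "asymp_below (\<lambda>_. t *\<^sub>S F x + (1 - t) *\<^sub>S F y + (\<Sum>k=0..n. w k t *\<^sub>S A' k))
      (\<lambda>_. F p + tabor B t (x - y))" .
  qed
  \<comment> \<open>The closure in \<open>tabor A\<close> is absorbed by \<open>below\<close>, and
    membership in the union is decided by a single partial sum, so \<open>partial\<close>
    suffices.\<close>
  have "t *\<^sub>S F x + (1 - t) *\<^sub>S F y + tabor A t (x - y)
      \<sqsubseteq> t *\<^sub>S F x + (1 - t) *\<^sub>S F y + (\<Union>n. \<Sum>k=0..n. w k t *\<^sub>S A' k)"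
    unfolding tabor_def w_def A'_def by (intro below_add below_refl below_closure order_refl)
  also have "\<dots> \<sqsubseteq> F p + tabor B t (x - y)"
    unfolding below_def
  proof
    fix z assume "z \<in> t *\<^sub>S F x + (1 - t) *\<^sub>S F y + (\<Union>n. \<Sum>k=0..n. w k t *\<^sub>S A' k)"
    then obtain n where "z \<in> t *\<^sub>S F x + (1 - t) *\<^sub>S F y + (\<Sum>k=0..n. w k t *\<^sub>S A' k)"
      by (auto elim!: set_plus_elim)
    then show "z \<in> closure (F p + tabor B t (x - y) + K)"
      using partial unfolding below_def by blast
  qed
  finally show "t *\<^sub>S F x + (1 - t) *\<^sub>S F y + tabor A t (x - y)
      \<subseteq> closure (F (t *\<^sub>R x + (1 - t) *\<^sub>R y) + tabor B t (x - y) + K)"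
    by (simp add: below_def p_def)
qed

end
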